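(* Let $W=W_\Phi$ be a tubular elliptic Weyl group of rank $n+2$ and $c\in W$ a Coxeter transformation. Then $[\mathrm{id},c]^{\mathrm{gen}}$ is rigid; that is, for all $(t_1,\dots,t_{n+2}),(r_1,\dots,r_{n+2})\in\mathrm{Red}_T(c)^{\mathrm{gen}}$ such that $t_1\cdots t_h=r_1\cdots r_h$ for some $1\le h\le n$, one has $(t_1,\dots,t_h,r_{h+1},\dots,r_{n+2})\in\mathrm{Red}_T(c)^{\mathrm{gen}}$.
   Context: Let $V$ be a finite dimensional real vector space with a positive semidefinite symmetric bilinear form $(\cdot\mid\cdot)$ whose radical $R$ is 2-dimensional. A (simply-laced) elliptic root system in $V$ is a non-empty subset $\Phi\subset V$ with $(\alpha\mid\alpha)=2$ for all $\alpha\in\Phi$, $\mathrm{span}_{\mathbb R}(\Phi)=V$, $s_\alpha(\Phi)\subseteq\Phi$ for all $\alpha\in\Phi$ where $s_\alpha(v)=v-(\alpha\mid v)\alpha$, $(\alpha\mid\beta)\in\mathbb Z$ for all $\alpha,\beta\in\Phi$, and such that $L(\Phi)=\mathrm{span}_{\mathbb Z}(\Phi)$ is a full lattice in $V$. It is irreducible if it is not a union of two non-empty mutually orthogonal subsets. Let $\Phi_{\mathrm{fin}}$ be the image of $\Phi$ in $V/R$; it is a finite root system. An irreducible $\Phi$ is called tubular if $\Phi_{\mathrm{fin}}$ is of type $D_4,E_6,E_7$ or $E_8$. Then $W=W_\Phi=\langle s_\alpha\mid\alpha\in\Phi\rangle$ is called a tubular elliptic Weyl group; its set of reflections is $T=\{s_\alpha\mid\alpha\in\Phi\}$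 and its rank is $\dim V=n+2$, where $n$ is the rank of $\Phi_{\mathrm{fin}}$. Elliptic root basis: choose a one-dimensional subspace $U\subset R$ with $L(\Phi)\cap U\neq 0$ and $a\in U$ with $L(\Phi)\cap U=\mathbb Za$. The image of $\Phi$ in $V/U$ is an irreducible affine root system; choose a simple system $\{\beta_0,\dots,\beta_n\}$ of it, numbered so that for (unique) positive integers $m_1,\dots,m_n$ the element $\beta_0+\sum_{i=1}^n m_i\beta_i$ generates the intersection of $\mathrm{span}_{\mathbb Z}\{\beta_0,\dots,\beta_n\}$ with $R/U$. Choose preimages $\alpha_i\in\Phi$ of $\beta_i$, $0\le i\le n$. There is a unique index $t\in\{1,\dots,n\}$ with $m_t=\max_{1\le i\le n} m_i$. Put $\alpha_t^*=\alpha_t+a$. Then $\Gamma=\{\alpha_0,\dots,\alpha_n,\alpha_t^*\}$ is an elliptic root basis, and a Coxeter transformation (with respect to $\Gamma$) is $c=\Big(\prod_{0\le i\le n,\,i\ne t}s_{\alpha_i}\Big)s_{\alpha_t}s_{\alpha_t^*}$, the first product being taken in an arbitrary order. One has $\ell_T(c)=n+2$, where $\ell_T$ is word length with respect to $T$. $\mathrm{Red}_T(c)^{\mathrm{gen}}$ is the set of $(t_1,\dots,t_{n+2})\in T^{n+2}$ with $c=t_1\cdots t_{n+2}$ and $W=\langle t_1,\dots,t_{n+2}\rangle$. $[\mathrm{id},c]^{\mathrm{gen}}$ is the set of all products $t_1\cdots t_m$ ($0\le m\le n+2$) of initial segments of elements of $\mathrm{Red}_T(c)^{\mathrm{gen}}$.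 *)

theory Defs
  imports "HOL-Analysis.Analysis" "HOL-Algebra.Generated_Groups"
begin

text \<open>The space $V$ is a whole type of class \<open>real_vector\<close>, assumed finite dimensional
  in \<open>elliptic_root_system\<close>.\<close>

definition radical :: "('a::real_vector \<Rightarrow> 'a \<Rightarrow> real) \<Rightarrow> 'a set" where
  "radical B = {x. \<forall>y. B x y = 0}"

definition refl_map :: "('a::real_vector \<Rightarrow> 'a \<Rightarrow> real) \<Rightarrow> 'a \<Rightarrow> 'a \<Rightarrow> 'a" where
  "refl_map B \<alpha> v = v - B \<alpha> v *\<^sub>R \<alpha>"

definition int_span :: "'a::real_vector set \<Rightarrow> 'a set" where
  "int_span S = {\<Sum>v\<in>F. of_int (k v) *\<^sub>R v | F (k :: 'a \<Rightarrow> int). finite F \<and> F \<subseteq> S}"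

definition full_lattice :: "'a::real_vector set \<Rightarrow> bool" where
  "full_lattice L \<longleftrightarrow> (\<exists>b. independent b \<and> span b = UNIV \<and> L = int_span b)"

definition elliptic_root_system :: "('a::real_vector \<Rightarrow> 'a \<Rightarrow> real) \<Rightarrow> 'a set \<Rightarrow> bool" where
  "elliptic_root_system B \<Phi> \<longleftrightarrow>
     (\<exists>b :: 'a set. finite b \<and> span b = UNIV) \<and>
     bilinear B \<and> (\<forall>x y. B x y = B y x) \<and> (\<forall>x. B x x \<ge> 0) \<and>
     dim (radical B) = 2 \<and>
     \<Phi> \<noteq> {} \<and>
     (\<forall>\<alpha>\<in>\<Phi>. B \<alpha> \<alpha> = 2) \<and>
     span \<Phi> = UNIV \<and>
     (\<forall>\<alpha>\<in>\<Phi>. refl_map B \<alpha> ` \<Phi> \<subseteq> \<Phi>) \<and>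
     (\<forall>\<alpha>\<in>\<Phi>. \<forall>\<beta>\<in>\<Phi>. B \<alpha> \<beta> \<in> \<int>) \<and>
     full_lattice (int_span \<Phi>)"

definition irreducible_roots :: "('a::real_vector \<Rightarrow> 'a \<Rightarrow> real) \<Rightarrow> 'a set \<Rightarrow> bool" where
  "irreducible_roots B \<Phi> \<longleftrightarrow>
     \<not> (\<exists>\<Phi>1 \<Phi>2. \<Phi>1 \<noteq> {} \<and> \<Phi>2 \<noteq> {} \<and> \<Phi> = \<Phi>1 \<union> \<Phi>2 \<and>
          (\<forall>\<alpha>\<in>\<Phi>1. \<forall>\<beta>\<in>\<Phi>2. B \<alpha> \<beta> = 0))"

text \<open>The canonical map from $V$ to $V/U$, with elements of the quotient represented as cosets.\<close>

definition coset :: "'a::real_vector set \<Rightarrow> 'a \<Rightarrow> 'a set" where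
  "coset U v = {w. w - v \<in> U}"

text \<open>\<open>simple_system U \<Psi> I \<gamma>\<close>: the classes in $V/U$ of the vectors $\gamma_i$ ($i \in I$) form a
  simple system of the root system $\Psi \subseteq V/U$.  Linear combinations in $V/U$ are formed
  on representatives.  The same definition serves finite root systems ($U$ the radical) and affine
  ones ($U$ a line in the radical, $\Psi$ then being the set of real roots).\<close>

definition simple_system ::
    "'a::real_vector set \<Rightarrow> 'a set set \<Rightarrow> nat set \<Rightarrow> (nat \<Rightarrow> 'a) \<Rightarrow> bool" where
  "simple_system U \<Psi> I \<gamma> \<longleftrightarrow>
     finite I \<and>
     (\<forall>i\<in>I. coset U (\<gamma> i) \<in> \<Psi>) \<and>
     (\<forall>x :: nat \<Rightarrow> real. coset U (\<Sum>i\<in>I. x i *\<^sub>R \<gamma> i) = coset U 0 \<longrightarrow> (\<forall>i\<in>I. x i = 0)) \<and>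
     (\<forall>\<beta>\<in>\<Psi>. \<exists>k :: nat \<Rightarrow> int.
         \<beta> = coset U (\<Sum>i\<in>I. of_int (k i) *\<^sub>R \<gamma> i) \<and>
         ((\<forall>i\<in>I. k i \<ge> 0) \<or> (\<forall>i\<in>I. k i \<le> 0)))"

datatype tubular_type = D4 | E6 | E7 | E8

primrec type_rank :: "tubular_type \<Rightarrow> nat" where
  "type_rank D4 = 4"
| "type_rank E6 = 6"
| "type_rank E7 = 7"
| "type_rank E8 = 8"

text \<open>Edges of the Dynkin diagrams on the nodes \<open>{1..type_rank X}\<close>, in Bourbaki's labelling.\<close>

primrec type_edges :: "tubular_type \<Rightarrow> nat set set" where
  "type_edges D4 = {{1,2}, {2,3}, {2,4}}"
| "type_edges E6 = {{1,3}, {3,4}, {4,5}, {5,6}, {2,4}}"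
| "type_edges E7 = {{1,3}, {3,4}, {4,5}, {5,6}, {6,7}, {2,4}}"
| "type_edges E8 = {{1,3}, {3,4}, {4,5}, {5,6}, {6,7}, {7,8}, {2,4}}"

text \<open>As all roots have square length 2, the Cartan matrix is the Gram matrix of the simple
  system; it does not depend on the representatives $\gamma_i$ of the classes in $V/R$.\<close>

definition fin_type ::
    "('a::real_vector \<Rightarrow> 'a \<Rightarrow> real) \<Rightarrow> 'a set \<Rightarrow> tubular_type \<Rightarrow> bool" where
  "fin_type B \<Phi> X \<longleftrightarrow>
     (\<exists>\<gamma>. simple_system (radical B) (coset (radical B) ` \<Phi>) {1..type_rank X} \<gamma> \<and>
        (\<forall>i\<in>{1..type_rank X}. \<forall>j\<in>{1..type_rank X}.
           B (\<gamma> i) (\<gamma> j) = (if i = j then 2 else if {i, j} \<in> type_edges X then -1 else 0)))"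

definition tubular_root_system :: "('a::real_vector \<Rightarrow> 'a \<Rightarrow> real) \<Rightarrow> 'a set \<Rightarrow> bool" where
  "tubular_root_system B \<Phi> \<longleftrightarrow>
     elliptic_root_system B \<Phi> \<and> irreducible_roots B \<Phi> \<and> (\<exists>X. fin_type B \<Phi> X)"

definition GL_V :: "('a::real_vector \<Rightarrow> 'a) monoid" where
  "GL_V = \<lparr>carrier = {f. linear f \<and> bij f}, monoid.mult = (\<circ>), one = id\<rparr>"

definition reflections :: "('a::real_vector \<Rightarrow> 'a \<Rightarrow> real) \<Rightarrow> 'a set \<Rightarrow> ('a \<Rightarrow> 'a) set" where
  "reflections B \<Phi> = refl_map B ` \<Phi>"

definition weyl_group :: "('a::real_vector \<Rightarrow> 'a \<Rightarrow> real) \<Rightarrow> 'a set \<Rightarrow> ('a \<Rightarrow> 'a) set" where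
  "weyl_group B \<Phi> = generate GL_V (reflections B \<Phi>)"

definition word_prod :: "('a \<Rightarrow> 'a) list \<Rightarrow> 'a \<Rightarrow> 'a" where
  "word_prod ts = foldr (\<circ>) ts id"

text \<open>\<open>elliptic_root_basis B \<Phi> n \<alpha> t a\<close>: the vectors $\alpha_0, \dots, \alpha_n$ and
  $\alpha_t^* = \alpha_t + a$ form an elliptic root basis of $\Phi$.  The displayed condition on
  \<open>\<delta>\<close> says that the class of \<open>\<delta>\<close> generates the intersection of
  $\mathrm{span}_{\mathbb Z}\{\beta_0, \dots, \beta_n\}$ with $R/U$, where $\beta_i$ is the class
  of $\alpha_i$ in $V/U$.\<close>

definition elliptic_root_basis ::
    "('a::real_vector \<Rightarrow> 'a \<Rightarrow> real) \<Rightarrow> 'a set \<Rightarrow> nat \<Rightarrow> (nat \<Rightarrow> 'a) \<Rightarrow> nat \<Rightarrow> 'a \<Rightarrow> bool" where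
  "elliptic_root_basis B \<Phi> n \<alpha> t a \<longleftrightarrow>
     (\<exists>U (m :: nat \<Rightarrow> nat).
        subspace U \<and> dim U = 1 \<and> U \<subseteq> radical B \<and>
        int_span \<Phi> \<inter> U \<noteq> {0} \<and>
        int_span \<Phi> \<inter> U = range (\<lambda>z::int. of_int z *\<^sub>R a) \<and>
        (\<forall>i\<in>{0..n}. \<alpha> i \<in> \<Phi>) \<and>
        simple_system U (coset U ` \<Phi>) {0..n} \<alpha> \<and>
        (\<forall>i\<in>{1..n}. m i > 0) \<and>
        (let \<delta> = \<alpha> 0 + (\<Sum>i\<in>{1..n}. of_nat (m i) *\<^sub>R \<alpha> i) in
           coset U ` int_span (\<alpha> ` {0..n}) \<inter> coset U ` radical B
             = range (\<lambda>z::int. coset U (of_int z *\<^sub>R \<delta>))) \<and>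
        t \<in> {1..n} \<and> m t = Max (m ` {1..n}))"

definition coxeter_transformation ::
    "('a::real_vector \<Rightarrow> 'a \<Rightarrow> real) \<Rightarrow> 'a set \<Rightarrow> nat \<Rightarrow> ('a \<Rightarrow> 'a) \<Rightarrow> bool" where
  "coxeter_transformation B \<Phi> n c \<longleftrightarrow>
     (\<exists>\<alpha> t a js.
        elliptic_root_basis B \<Phi> n \<alpha> t a \<and>
        distinct js \<and> set js = {0..n} - {t} \<and>
        c = word_prod (map (\<lambda>j. refl_map B (\<alpha> j)) js)
              \<circ> refl_map B (\<alpha> t) \<circ> refl_map B (\<alpha> t + a))"

definition Red_gen ::
    "('a::real_vector \<Rightarrow> 'a \<Rightarrow> real) \<Rightarrow> 'a set \<Rightarrow> nat \<Rightarrow> ('a \<Rightarrow> 'a) \<Rightarrow> ('a \<Rightarrow> 'a) list set" where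
  "Red_gen B \<Phi> n c =
     {ts. length ts = n + 2 \<and> set ts \<subseteq> reflections B \<Phi> \<and> word_prod ts = c \<and>
          generate GL_V (set ts) = weyl_group B \<Phi>}"

end

theory Submission
  imports Defs
begin

text \<open>The roots $\alpha_1, \dots, \alpha_{n+2}$ of a generating factorization of $c$ form a
  $\mathbb{Z}$-basis of $L(\Phi)$.  If the span of an initial (or final) part of the factorization
  meets the radical $R$ trivially, it equals the image of $1 - w$, where $w$ is the product of that
  part.  Hence it depends only on $w$, and so do the lattice spanned by the part (as the roots are part
  of a basis of $L(\Phi)$) and the group it generates (as in a positive definite lattice generated by
  roots every vector of norm 2 is conjugate to a generator).  Thus it remains to see that the spans of
  the initial and of the final part do not both meet $R$.  The unitriangular Euler form of the
  factorization vanishes on pairs of vectors from the final and the initial part, while it is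
  nondegenerate on $R$, because $c$ has no fixed vectors modulo $R$.\<close>

section \<open>Integral spans\<close>

lemma zero_in_int_span: "0 \<in> int_span S"
  unfolding int_span_def by (rule CollectI, rule exI[of _ "{}"]) auto

lemma base_in_int_span: "x \<in> S \<Longrightarrow> x \<in> int_span S"
  unfolding int_span_def by (rule CollectI, rule exI[of _ "{x}"], rule exI[of _ "\<lambda>_. 1"]) auto

lemma int_span_subset_span: "int_span S \<subseteq> span S"
  unfolding int_span_def by (auto intro!: span_sum span_scale intro: span_base)

lemma int_span_add:
  assumes "x \<in> int_span S" "y \<in> int_span S"
  shows "x + y \<in> int_span S"
proof -
  obtain F k where F: "finite F" "F \<subseteq> S" "x = (\<Sum>v\<in>F. of_int (k v) *\<^sub>R v)"
    using assms(1) unfolding int_span_def by auto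
  obtain G l where G: "finite G" "G \<subseteq> S" "y = (\<Sum>v\<in>G. of_int (l v) *\<^sub>R v)"
    using assms(2) unfolding int_span_def by auto
  let ?m = "\<lambda>v. (if v \<in> F then k v else 0) + (if v \<in> G then l v else 0)"
  have "x = (\<Sum>v\<in>F \<union> G. of_int (if v \<in> F then k v else 0) *\<^sub>R v)"
    unfolding F(3) using F(1) G(1) by (intro sum.mono_neutral_cong_left) auto
  moreover have "y = (\<Sum>v\<in>F \<union> G. of_int (if v \<in> G then l v else 0) *\<^sub>R v)"
    unfolding G(3) using F(1) G(1) by (intro sum.mono_neutral_cong_left) auto
  ultimately have "x + y = (\<Sum>v\<in>F \<union> G. of_int (?m v) *\<^sub>R v)"
    by (simp only: of_int_add scaleR_left_distrib sum.distrib)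
  then show ?thesis
    unfolding int_span_def using F G
    by (intro CollectI exI[of _ "F \<union> G"] exI[of _ ?m]) auto
qed

lemma int_span_scale:
  assumes "x \<in> int_span S"
  shows "of_int z *\<^sub>R x \<in> int_span S"
proof -
  obtain F k where F: "finite F" "F \<subseteq> S" "x = (\<Sum>v\<in>F. of_int (k v) *\<^sub>R v)"
    using assms unfolding int_span_def by auto
  then show ?thesis
    unfolding int_span_def
    by (intro CollectI exI[of _ F] exI[of _ "\<lambda>v. z * k v"]) (auto simp: scaleR_sum_right)
qed

lemma int_span_minus: "x \<in> int_span S \<Longrightarrow> - x \<in> int_span S"
  using int_span_scale[of x S "-1"] by simp

lemma int_span_diff: "x \<in> int_span S \<Longrightarrow> y \<in> int_span S \<Longrightarrow> x - y \<in> int_span S"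
  using int_span_add[of x S "- y"] int_span_minus[of y S] by simp

lemma int_span_minimal:
  assumes "S \<subseteq> L" "0 \<in> L" "\<And>x y. x \<in> L \<Longrightarrow> y \<in> L \<Longrightarrow> x + y \<in> L"
    "\<And>x z. x \<in> L \<Longrightarrow> of_int z *\<^sub>R x \<in> L"
  shows "int_span S \<subseteq> L"
proof -
  have "(\<Sum>v\<in>F. of_int (k v) *\<^sub>R v) \<in> L" if "finite F" "F \<subseteq> S" for F and k :: "'a \<Rightarrow> int"
    using that by (induction F rule: finite_induct) (use assms in auto)
  then show ?thesis unfolding int_span_def by auto
qed

lemma int_span_mono: "S \<subseteq> int_span T \<Longrightarrow> int_span S \<subseteq> int_span T"
  by (rule int_span_minimal) (auto intro: zero_in_int_span int_span_add int_span_scale)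

text \<open>Prepares inductions on the number of summands. Signed finite sums satisfy all closure
  conditions of \<open>int_span_minimal\<close>.\<close>

lemma int_span_sum_list:
  assumes "x \<in> int_span S"
  obtains gs where "set gs \<subseteq> S \<union> uminus ` S" "x = sum_list gs"
proof -
  let ?L = "{sum_list gs | gs. set gs \<subseteq> S \<union> uminus ` S}"
  have neg: "- y \<in> ?L" if y: "y \<in> ?L" for y
  proof -
    obtain gs where gs: "set gs \<subseteq> S \<union> uminus ` S" "y = sum_list gs" using y by auto
    have "- y = sum_list (map uminus gs)" unfolding gs(2) by (induction gs) auto
    moreover have "set (map uminus gs) \<subseteq> S \<union> uminus ` S"
      using gs(1) by (force simp: image_iff)
    ultimately show ?thesis by blast
  qed
  have add: "y + z \<in> ?L" if yz: "y \<in> ?L" "z \<in> ?L" for y z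
  proof -
    obtain gs hs where "set gs \<subseteq> S \<union> uminus ` S" "y = sum_list gs"
      "set hs \<subseteq> S \<union> uminus ` S" "z = sum_list hs" using yz by blast
    then show ?thesis by (intro CollectI exI[of _ "gs @ hs"]) auto
  qed
  have zero: "0 \<in> ?L" by (intro CollectI exI[of _ "[]"]) auto
  have nat: "of_nat m *\<^sub>R y \<in> ?L" if "y \<in> ?L" for m y
  proof (induction m)
    case 0 show ?case unfolding of_nat_0 scaleR_zero_left by (rule zero)
  next
    case (Suc m) show ?case
      unfolding of_nat_Suc scaleR_left_distrib scaleR_one by (rule add[OF that Suc])
  qed
  have scale: "of_int z *\<^sub>R y \<in> ?L" if y: "y \<in> ?L" for z y
  proof (cases z rule: int_cases2)
    case (nonneg m) then show ?thesis using nat[OF y, of m] by simp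
  next
    case (nonpos m) then show ?thesis using neg[OF nat[OF y, of m]] by simp
  qed
  have "S \<subseteq> ?L"
  proof
    fix s assume "s \<in> S" then show "s \<in> ?L" by (intro CollectI exI[of _ "[s]"]) auto
  qed
  from int_span_minimal[OF this zero add scale] assms have "x \<in> ?L" by blast
  then show thesis using that by blast
qed

text \<open>By independence the integral expansion over \<open>b\<close> and the real one over
  \<open>P\<close> agree coefficientwise, so the integer coefficients outside \<open>P\<close>
  vanish.\<close>

lemma int_span_Int_span:
  assumes "independent b" "P \<subseteq> b" "x \<in> int_span b" "x \<in> span P"
  shows "x \<in> int_span P"
proof -
  obtain F k where F: "finite F" "F \<subseteq> b" "x = (\<Sum>v\<in>F. of_int (k v) *\<^sub>R v)"
    using assms(3) unfolding int_span_def by auto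
  obtain G u where G: "finite G" "G \<subseteq> P" "x = (\<Sum>v\<in>G. u v *\<^sub>R v)"
    using assms(4) unfolding span_explicit by auto
  let ?d = "\<lambda>v. (if v \<in> F then of_int (k v) else 0) - (if v \<in> G then u v else 0)"
  have "x = (\<Sum>v\<in>F \<union> G. (if v \<in> F then of_int (k v) else 0) *\<^sub>R v)"
    unfolding F(3) using F(1) G(1) by (intro sum.mono_neutral_cong_left) auto
  moreover have "x = (\<Sum>v\<in>F \<union> G. (if v \<in> G then u v else 0) *\<^sub>R v)"
    unfolding G(3) using F(1) G(1) by (intro sum.mono_neutral_cong_left) auto
  ultimately have "(\<Sum>v\<in>F \<union> G. ?d v *\<^sub>R v) = 0"
    by (simp only: scaleR_left_diff_distrib sum_subtractf) simp
  then have d: "?d v = 0" if "v \<in> F \<union> G" for v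
    using independentD[OF assms(1), of "F \<union> G" ?d v] F(1,2) G(1,2) assms(2) that by blast
  have "of_int (k v) = (0::real)" if "v \<in> F" "v \<notin> P" for v
    using d[of v] that G(2) by (auto split: if_splits)
  then have "x = (\<Sum>v\<in>F \<inter> P. of_int (k v) *\<^sub>R v)"
    unfolding F(3) using F(1) by (intro sum.mono_neutral_right) auto
  then show ?thesis
    unfolding int_span_def using F(1) by (intro CollectI exI[of _ "F \<inter> P"] exI[of _ k]) auto
qed

section \<open>Finite-dimensional linear algebra\<close>

text \<open>Finite dimension is a hypothesis on \<open>b\<close>, not part of the type class. A
  basis \<open>c\<close> extracted from \<open>b\<close> instantiates
  \<open>finite_dimensional_vector_space\<close>, whose facts are then restated for the real
  \<open>span\<close> and \<open>dim\<close>.\<close>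

lemma finite_dimensional_facts:
  fixes S T :: "'a::real_vector set"
  assumes "finite (b :: 'a set)" "span b = UNIV"
  shows linear_inj_imp_surj_fd: "\<And>f :: 'a \<Rightarrow> 'a. linear f \<Longrightarrow> inj f \<Longrightarrow> surj f"
    and card_le_dim_spanning_fd: "\<lbrakk>span T = UNIV; finite T; card T \<le> dim (UNIV :: 'a set)\<rbrakk> \<Longrightarrow> independent T"
    and card_ge_dim_independent_fd: "\<lbrakk>S \<subseteq> T; independent S; dim T \<le> card S\<rbrakk> \<Longrightarrow> T \<subseteq> span S"
proof -
  obtain c where c: "c \<subseteq> b" "independent c" "b \<subseteq> span c"
    by (rule real_vector.maximal_independent_subset)
  have "finite c" using c(1) assms(1) finite_subset by blast
  moreover have "span c = UNIV"
    using c(3) assms(2) by (metis span_eq span_span top.extremum_uniqueI span_minimal subspace_span)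
  ultimately interpret fd: finite_dimensional_vector_space "scaleR :: real \<Rightarrow> 'a \<Rightarrow> 'a" c
    using c(2) by unfold_locales (auto simp: span_raw_def dependent_raw_def)
  show "surj f" if "linear f" "inj f" for f :: "'a \<Rightarrow> 'a"
    using fd.linear_inj_imp_surj that by (simp add: linear_def)
  show "independent T" if "span T = UNIV" "finite T" "card T \<le> dim (UNIV :: 'a set)"
    using fd.card_le_dim_spanning[of T UNIV] that
    by (auto simp: span_raw_def dependent_raw_def dim_raw_def)
  show "T \<subseteq> span S" if "S \<subseteq> T" "independent S" "dim T \<le> card S"
    using fd.card_ge_dim_independent[of S T] that
    by (auto simp: span_raw_def dependent_raw_def dim_raw_def)
qed

text \<open>Such projections build endomorphisms of the whole space, to which
  \<open>linear_inj_imp_surj_fd\<close> applies.\<close>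

lemma linear_projection_exists:
  fixes K :: "'a::real_vector set"
  assumes "subspace K"
  obtains p where "linear p" "\<And>v. p v \<in> K" "\<And>v. v \<in> K \<Longrightarrow> p v = v"
proof -
  have "\<exists>p. range p \<subseteq> K \<and> linear p \<and> (\<forall>v\<in>K. p (id v) = v)"
    by (rule real_vector.linear_exists_left_inverse_on[OF linear_id assms]) simp
  then show thesis using that by (auto simp: image_subset_iff)
qed

section \<open>The group of linear bijections\<close>

lemma group_GL_V: "group (GL_V :: ('a::real_vector \<Rightarrow> 'a) monoid)"
proof (rule groupI)
  fix f :: "'a \<Rightarrow> 'a" assume "f \<in> carrier GL_V"
  then have f: "linear f" "bij f" by (auto simp: GL_V_def)
  then obtain g where g: "linear g" "g \<circ> f = id"
    using linear_injective_left_inverse[of f] by (auto simp: bij_def)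
  then have "g = inv_into UNIV f" using f(2) by (metis bij_def inv_unique_comp surj_iff fun.map_comp comp_id id_comp)
  then have "bij g" using f(2) bij_imp_bij_inv by blast
  then show "\<exists>g\<in>carrier GL_V. g \<otimes>\<^bsub>GL_V\<^esub> f = \<one>\<^bsub>GL_V\<^esub>"
    using g by (intro bexI[of _ g]) (auto simp: GL_V_def)
qed (auto simp: GL_V_def bij_comp linear_compose o_assoc linear_id id_def[symmetric])

section \<open>Products of reflections\<close>

locale psd_form =
  fixes B :: "'a::real_vector \<Rightarrow> 'a \<Rightarrow> real"
  assumes bilin: "bilinear B"
    and sym: "B x y = B y x"
    and nonneg: "B x x \<ge> 0"
begin

abbreviation s where "s \<equiv> refl_map B"

abbreviation R where "R \<equiv> radical B"

definition W where "W p = word_prod (map s p)"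

abbreviation G where "G p \<equiv> generate GL_V (s ` set p)"

lemmas form_simps [simp] = bilinear_ladd[OF bilin] bilinear_radd[OF bilin]
  bilinear_lsub[OF bilin] bilinear_rsub[OF bilin] bilinear_lmul[OF bilin] bilinear_rmul[OF bilin]
  bilinear_lneg[OF bilin] bilinear_rneg[OF bilin] bilinear_lzero[OF bilin] bilinear_rzero[OF bilin]

lemma linear_form: "linear (B x)"
  using bilin by (simp add: bilinear_def)

lemma subspace_radical: "subspace R"
  by (simp add: subspace_def radical_def)

lemma radicalD: "x \<in> R \<Longrightarrow> B x y = 0" "x \<in> R \<Longrightarrow> B y x = 0"
  using sym by (auto simp: radical_def)

lemma isotropic_imp_radical:
  assumes "B x x = 0"
  shows "x \<in> R"
proof -
  have "B x y = 0" for y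
  proof (rule ccontr)
    assume "B x y \<noteq> 0"
    \<comment> \<open>Solves \<open>B y y + 2 * r * B x y = -1\<close>, which semidefiniteness
      forbids.\<close>
    define r where "r = - (B y y + 1) / (2 * B x y)"
    have "B (y + r *\<^sub>R x) (y + r *\<^sub>R x) = B y y + 2 * r * B x y"
      using assms sym[of y x] by (simp add: algebra_simps)
    also have "\<dots> = - 1" using \<open>B x y \<noteq> 0\<close> by (simp add: r_def field_simps)
    finally show False using nonneg[of "y + r *\<^sub>R x"] by simp
  qed
  then show ?thesis by (simp add: radical_def)
qed

lemma linear_refl: "linear (s a)"
  by (rule linearI) (simp_all add: refl_map_def algebra_simps)

lemma refl_refl: "B a a = 2 \<Longrightarrow> s a (s a v) = v"
  by (simp add: refl_map_def algebra_simps)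

lemma refl_minus: "s (- a) = s a"
  by (simp add: refl_map_def fun_eq_iff)

lemma refl_in_GL:
  assumes "B a a = 2"
  shows "s a \<in> carrier GL_V"
proof -
  have "bij (s a)" by (rule o_bij[of "s a"]) (simp_all add: fun_eq_iff refl_refl assms)
  then show ?thesis by (simp add: GL_V_def linear_refl)
qed

lemma refl_conj:
  assumes "B g g = 2"
  shows "s (s g a) = s g \<circ> s a \<circ> s g"
  using assms sym[of g a] by (simp add: fun_eq_iff refl_map_def algebra_simps)

lemma W_Nil [simp]: "W [] v = v"
  by (simp add: W_def word_prod_def)

lemma W_Cons [simp]: "W (a # p) v = s a (W p v)"
  by (simp add: W_def word_prod_def)

lemma W_append: "W (p @ q) v = W p (W q v)"
  by (induction p) auto

lemma linear_W: "linear (W p)"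
proof (induction p)
  case Nil show ?case by (simp add: W_def word_prod_def linear_id[unfolded id_def])
next
  case (Cons a p)
  have "W (a # p) = s a \<circ> W p" by (simp add: W_def word_prod_def)
  then show ?case by (simp only: linear_compose[OF Cons linear_refl])
qed

lemma bij_W:
  assumes "\<forall>a\<in>set p. B a a = 2"
  shows "bij (W p)"
  using assms
proof (induction p)
  case Nil show ?case by (simp add: W_def word_prod_def bij_id[unfolded id_def])
next
  case (Cons a p)
  have W: "W (a # p) = s a \<circ> W p" by (simp add: W_def word_prod_def)
  have "bij (s a)" using refl_in_GL[of a] Cons.prems by (simp add: GL_V_def)
  moreover have "bij (W p)" using Cons by simp
  ultimately show ?case unfolding W by (intro bij_comp)
qed

section \<open>The image of 1 - \<open>W p\<close> and the vectors fixed by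
  \<open>W p\<close>\<close>

lemma W_diff_in_span: "v - W p v \<in> span (set p)"
proof (induction p)
  case Nil show ?case by simp
next
  case (Cons a p)
  have "v - W (a # p) v = (v - W p v) + B a (W p v) *\<^sub>R a"
    by (simp add: refl_map_def)
  moreover have "v - W p v \<in> span (set (a # p))"
    using Cons span_mono[of "set p" "set (a # p)"] by auto
  moreover have "B a (W p v) *\<^sub>R a \<in> span (set (a # p))"
    by (intro span_scale span_base) simp
  ultimately show ?case by (simp only: span_add)
qed

text \<open>Linear independence modulo the span of \<open>K\<close>, in a recursive form that
  matches peeling reflections off the left of \<open>W\<close>. It is applied with \<open>K\<close>
  empty and with \<open>K\<close> the radical.\<close>

fun indep_mod :: "'a set \<Rightarrow> 'a list \<Rightarrow> bool" where
  "indep_mod K [] \<longleftrightarrow> True"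
| "indep_mod K (a # p) \<longleftrightarrow> a \<notin> span (K \<union> set p) \<and> indep_mod K p"

lemma indep_mod_empty:
  assumes "distinct p" "independent (set p)"
  shows "indep_mod {} p"
  using assms
proof (induction p)
  case (Cons a p)
  then show ?case using independent_insert[of a "set p"] by simp
qed simp

text \<open>The leftmost reflection contributes a multiple of its root \<open>b\<close>, and
  everything else lies in the span of \<open>K\<close> and the remaining roots. Independence makes
  this multiple zero, and the induction continues with \<open>p\<close>.\<close>

lemma orthogonal_if_fixed:
  assumes "indep_mod K p" "K \<subseteq> R" "v - W p v \<in> span K" "a \<in> set p"
  shows "B a v = 0"
  using assms(1,3,4)
proof (induction p)
  case (Cons b p)
  let ?x = "B b (W p v)"
  have eq: "v - W (b # p) v = (v - W p v) + ?x *\<^sub>R b"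
    by (simp add: refl_map_def)
  have "?x *\<^sub>R b = (v - W (b # p) v) - (v - W p v)" unfolding eq by simp
  also have "\<dots> \<in> span (K \<union> set p)"
    by (rule span_diff) (meson Cons.prems(2) W_diff_in_span Un_upper1 Un_upper2 span_mono subsetD)+
  finally have x: "?x = 0"
    using Cons.prems(1) span_scale[of "?x *\<^sub>R b" "K \<union> set p" "inverse ?x"] by (cases "?x = 0") auto
  then have K: "v - W p v \<in> span K" using Cons.prems(2) eq by simp
  \<comment> \<open>Since \<open>v\<close> and \<open>W p v\<close> differ by a radical vector,
    \<open>b\<close> has the same pairing with both.\<close>
  then have "v - W p v \<in> R"
    using span_minimal[OF assms(2) subspace_radical] by blast
  then have "B b v = 0" using radicalD(2)[of "v - W p v" b] x by simp
  then show ?case using Cons K by auto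
qed simp

text \<open>A vector of the span fixed by \<open>W p\<close> is orthogonal to the whole span, hence
  isotropic, hence radical and so zero. Thus 1 - \<open>W p\<close> is injective on the span, which
  it maps to itself, and finite dimension makes it onto.\<close>

lemma range_W_diff:
  assumes "distinct p" "independent (set p)" "span (set p) \<inter> R \<subseteq> {0}"
    and fd: "finite (b :: 'a set)" "span b = UNIV"
    and x: "x \<in> span (set p)"
  obtains v where "x = v - W p v"
proof -
  obtain \<pi> where \<pi>: "linear \<pi>" "\<And>v. \<pi> v \<in> span (set p)" "\<And>v. v \<in> span (set p) \<Longrightarrow> \<pi> v = v"
    by (rule linear_projection_exists[OF subspace_span[of "set p"]]) (rule that)
  \<comment> \<open>\<open>1 - W p\<close> on the span, extended by the identity on a complement\<close>
  define g where "g v = (\<pi> v - W p (\<pi> v)) + (v - \<pi> v)" for v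
  have "linear (\<lambda>v. W p (\<pi> v))"
    using linear_compose[OF \<pi>(1) linear_W[of p]] by (simp add: o_def)
  then have lin: "linear g"
    unfolding g_def[abs_def] using \<pi>(1) by (intro linear_compose_add linear_compose_sub linear_ident)
  \<comment> \<open>\<open>g\<close> changes a vector only by elements of the span, so preimages of
    span vectors stay in the span, where \<open>g\<close> is 1 - \<open>W p\<close>.\<close>
  have mem: "v \<in> span (set p)" if "g v \<in> span (set p)" for v
  proof -
    have "v = g v - (\<pi> v - W p (\<pi> v)) + \<pi> v" by (simp add: g_def)
    also have "\<dots> \<in> span (set p)"
      by (intro span_add span_diff that W_diff_in_span \<pi>(2))
    finally show ?thesis .
  qed
  have "inj g"
  proof (rule linear_injective_0[OF lin, THEN iffD2, rule_format])
    fix v assume v: "g v = 0"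
    have vp: "v \<in> span (set p)" by (rule mem) (simp only: v span_zero)
    have "v - W p v = 0" using v vp \<pi>(3) by (simp add: g_def)
    then have ort: "B a v = 0" if "a \<in> set p" for a
      using orthogonal_if_fixed[OF indep_mod_empty, of p v a] assms(1,2) that span_zero by simp
    have "B v a = 0" if "a \<in> span (set p)" for a
      using linear_eq_0_on_span[OF linear_form[of v], of "set p" a] ort that sym by auto
    then show "v = 0" using isotropic_imp_radical[of v] vp assms(3) by auto
  qed
  then obtain v where v: "x = g v"
    using linear_inj_imp_surj_fd[OF fd lin] by (metis surjD)
  then have "v \<in> span (set p)" using mem x by simp
  then show thesis using that[of v] \<pi>(3) by (simp add: v g_def)
qed

text \<open>The span of \<open>p\<close> is the image of 1 - \<open>W p\<close> = 1 -
  \<open>W q\<close>, which lies in the span of \<open>q\<close>. The equal lengths bound the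
  dimension of the latter.\<close>

lemma span_eq_if_W_eq:
  assumes "distinct p" "independent (set p)" "span (set p) \<inter> R \<subseteq> {0}"
    and fd: "finite (b :: 'a set)" "span b = UNIV"
    and "W p = W q" "length q = length p"
  shows "span (set p) = span (set q)"
proof -
  have sub: "span (set p) \<subseteq> span (set q)"
  proof
    fix x assume "x \<in> span (set p)"
    then obtain v where "x = v - W p v"
      using range_W_diff[OF assms(1-3) fd] by blast
    then show "x \<in> span (set q)" using W_diff_in_span[of v q] assms(6) by simp
  qed
  have "dim (span (set q)) \<le> card (set q)" by (simp add: dim_le_card')
  also have "\<dots> \<le> card (set p)"
    using card_length[of q] assms(1,7) by (simp add: distinct_card)
  finally have "span (set q) \<subseteq> span (set p)"
    using card_ge_dim_independent_fd[OF fd, of "set p" "span (set q)"] assms(2) sub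
      span_superset[of "set p"] by blast
  then show ?thesis using sub by simp
qed

section \<open>Reflections generated by a part whose span avoids the radical\<close>

text \<open>If $\beta$ has norm 2 and is a sum of roots, then some summand $g$ has $B(\beta, g) = 1$ (or
  equals $\beta$), and $\beta = s_g(\beta - g)$, where $\beta - g$ is a shorter sum.\<close>

lemma refl_in_generate_if_sum_list:
  assumes P: "\<forall>a\<in>set p. B a a = 2" "\<forall>a\<in>set p. \<forall>b\<in>set p. B a b \<in> \<int>"
    and R: "span (set p) \<inter> R \<subseteq> {0}"
    and gs: "\<forall>g\<in>set gs. B g g = 2 \<and> g \<in> int_span (set p) \<and> s g \<in> G p"
    and two: "B (sum_list gs) (sum_list gs) = 2"
  shows "s (sum_list gs) \<in> G p"
  using gs two
proof (induction "length gs" arbitrary: gs)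
  case (Suc m)
  let ?b = "sum_list gs"
  have int: "B x y \<in> \<int>" if "x \<in> int_span (set p)" "y \<in> int_span (set p)" for x y
  proof -
    have "int_span (set p) \<subseteq> {y. \<forall>a\<in>set p. B a y \<in> \<int>}"
      using P(2) by (intro int_span_minimal) auto
    then have "int_span (set p) \<subseteq> {x. B x y \<in> \<int>}"
      using that(2) sym by (intro int_span_minimal) auto
    then show ?thesis using that by auto
  qed
  have b: "sum_list hs \<in> int_span (set p)" if "set hs \<subseteq> set gs" for hs
    using that Suc.prems(1) by (induction hs) (auto intro: zero_in_int_span int_span_add)
  have "B x (sum_list hs) = (\<Sum>g\<leftarrow>hs. B x g)" for x hs
    by (induction hs) auto
  then have "B ?b ?b = (\<Sum>g\<leftarrow>gs. B ?b g)" .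
  \<comment> \<open>The pairings of the sum with its summands add up to 2, so one of them is
    positive.\<close>
  then obtain g where g: "g \<in> set gs" "B ?b g > 0"
    using Suc.prems(2) sum_list_nonpos[of "map (B ?b) gs"] by (force simp: not_less)
  have gg: "B g g = 2" and gL: "g \<in> int_span (set p)" and gG: "s g \<in> G p"
    using Suc.prems(1) g(1) by auto
  obtain k where k: "B ?b g = of_int k" using int[OF b gL] by (auto elim: Ints_cases)
  have norm: "B (?b - g) (?b - g) = 4 - 2 * of_int k"
    using Suc.prems(2) gg k sym[of g ?b] by simp
  then have "4 - 2 * real_of_int k \<ge> 0" using nonneg by metis
  then have "k = 1 \<or> k = 2" using g(2) k by auto
  then show ?case
  proof
    \<comment> \<open>The sum and \<open>g\<close> now differ by an isotropic vector of the span, so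
      they coincide.\<close>
    assume "k = 2"
    then have "?b - g \<in> R" using norm isotropic_imp_radical by simp
    moreover have "?b - g \<in> span (set p)"
      using int_span_diff[OF b gL] int_span_subset_span by blast
    ultimately have "?b = g" using R by auto
    then show ?thesis using gG by simp
  next
    assume "k = 1"
    define h where "h = sum_list (remove1 g gs)"
    have hb: "h = ?b - g" using sum_list_map_remove1[OF g(1), of id] by (simp add: h_def)
    then have hh: "B h h = 2" using norm \<open>k = 1\<close> by simp
    have "set (remove1 g gs) \<subseteq> set gs" by (rule set_remove1_subset)
    then have hG: "s h \<in> G p"
      unfolding h_def using Suc.hyps(2) Suc.prems(1) g(1) hh[unfolded h_def]
      by (intro Suc.hyps(1)) (auto simp: length_remove1)
    have "B g h = -1" using hb gg k \<open>k = 1\<close> sym[of g ?b] by simp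
    then have "?b = s g h" using hb by (simp add: refl_map_def)
    then have "s ?b = s g \<circ> s h \<circ> s g" using refl_conj[OF gg] by simp
    then show ?thesis
      using generate.eng[OF generate.eng[OF gG hG] gG] by (simp add: GL_V_def)
  qed
qed simp

lemma refl_in_generate:
  assumes P: "\<forall>a\<in>set p. B a a = 2" "\<forall>a\<in>set p. \<forall>b\<in>set p. B a b \<in> \<int>"
    and "span (set p) \<inter> R \<subseteq> {0}" "x \<in> int_span (set p)" "B x x = 2"
  shows "s x \<in> G p"
proof -
  obtain gs where gs: "set gs \<subseteq> set p \<union> uminus ` set p" "x = sum_list gs"
    by (rule int_span_sum_list[OF assms(4)])
  have "B g g = 2 \<and> g \<in> int_span (set p) \<and> s g \<in> G p" if "g \<in> set gs" for g
  proof -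
    obtain a where a: "a \<in> set p" "g = a \<or> g = - a" using \<open>g \<in> set gs\<close> gs(1) by auto
    have "a \<in> int_span (set p)" "s a \<in> G p"
      using a(1) by (auto intro: base_in_int_span generate.incl)
    then show ?thesis using a P(1) int_span_minus by (auto simp: refl_minus)
  qed
  then show ?thesis
    using refl_in_generate_if_sum_list[OF assms(1-3), of gs] assms(5) gs(2) by auto
qed

text \<open>For exchanging one part of a factorization: \<open>q\<close> is replaced by
  \<open>p\<close>, while \<open>T\<close> holds the reflections of the part that is kept. By
  \<open>refl_in_generate\<close> the reflections of \<open>q\<close> already lie in
  \<open>G p\<close>.\<close>

lemma generate_mix:
  assumes P: "\<forall>a\<in>set p. B a a = 2" "\<forall>a\<in>set p. \<forall>b\<in>set p. B a b \<in> \<int>"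
    and Q: "\<forall>a\<in>set q. B a a = 2 \<and> a \<in> int_span (set p)"
    and R: "span (set p) \<inter> R \<subseteq> {0}"
    and T: "\<forall>f\<in>T. f \<in> carrier GL_V"
  shows "generate GL_V (s ` set q \<union> T) \<subseteq> generate GL_V (s ` set p \<union> T)"
proof -
  interpret GL: group "GL_V :: ('a \<Rightarrow> 'a) monoid" by (rule group_GL_V)
  have "s ` set q \<subseteq> G p" using refl_in_generate[OF P R] Q by auto
  then have "s ` set q \<union> T \<subseteq> generate GL_V (s ` set p \<union> T)"
    using GL.mono_generate[of "s ` set p" "s ` set p \<union> T"] by (auto intro: generate.incl)
  moreover have "subgroup (generate GL_V (s ` set p \<union> T)) GL_V"
    using P(1) T refl_in_GL by (intro GL.generate_is_subgroup) auto
  ultimately show ?thesis by (rule GL.generate_subgroup_incl)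
qed

section \<open>The Euler form of a factorization\<close>

text \<open>The coordinate functional of \<open>a\<close>, for adjusting a functional at
  \<open>a\<close> without changing it on the span of \<open>S\<close>.\<close>

lemma separating_functional:
  assumes "independent (insert a (S :: 'a set))" "a \<notin> S"
  obtains \<eta> :: "'a \<Rightarrow> real" where "linear \<eta>" "\<eta> a = 1" "\<And>x. x \<in> span S \<Longrightarrow> \<eta> x = 0"
proof -
  obtain \<eta> :: "'a \<Rightarrow> real" where \<eta>: "linear \<eta>"
    "\<forall>x\<in>insert a S. \<eta> x = (if x = a then 1 else 0)"
    using linear_independent_extend[OF assms(1), of "\<lambda>x. if x = a then 1 else 0"] by auto
  then have "\<forall>x\<in>S. \<eta> x = 0" using assms(2) by auto
  then have "\<eta> x = 0" if "x \<in> span S" for x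
    using linear_eq_0_on_span[OF \<eta>(1), of S x] that by auto
  then show thesis using that \<eta> by auto
qed

text \<open>Let $E$ be the bilinear form that is unitriangular in the basis \<open>p\<close>, with $E(a, b) = B(a, b)$
  if $a$ precedes $b$ in \<open>p\<close>, so that $E + E^T = B$.  Then $E(y, v - Wv) = B(y, v)$ for the
  product $W$ of the reflections, and the functional \<open>\<phi>\<close> below is $E(y, \cdot)$.\<close>

lemma euler_functional:
  assumes "distinct p" "independent (set p)" "\<forall>a\<in>set p. B a a = 2" "y \<in> span (set p)"
  shows "\<exists>\<phi>. linear \<phi> \<and> (\<forall>v. \<phi> (v - W p v) = B y v) \<and> \<phi> y = B y y / 2 \<and>
    (\<forall>p1 p2. p = p1 @ p2 \<and> y \<in> span (set p2) \<longrightarrow> (\<forall>x\<in>set p1. \<phi> x = 0)) \<and>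
    ((\<forall>x\<in>set p. \<phi> x = 0) \<longrightarrow> y = 0)"
  using assms
proof (induction p arbitrary: y)
  case Nil
  then show ?case by (intro exI[of _ "\<lambda>_. 0"]) (auto simp: linear_zero)
next
  case (Cons a p)
  have ind: "independent (insert a (set p))" and ap: "a \<notin> set p" and aa: "B a a = 2"
    using Cons.prems by auto
  then have indp: "independent (set p)" and anot: "a \<notin> span (set p)"
    using independent_insert[of a "set p"] by auto
  obtain \<eta> :: "'a \<Rightarrow> real" where \<eta>: "linear \<eta>" "\<eta> a = 1" "\<And>x. x \<in> span (set p) \<Longrightarrow> \<eta> x = 0"
    using separating_functional[OF ind ap] by blast
  obtain r where r: "y - r *\<^sub>R a \<in> span (set p)"
    using Cons.prems(4) by (auto simp: span_insert)
  define y' where "y' = y - r *\<^sub>R a"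
  have y: "y = r *\<^sub>R a + y'" by (simp add: y'_def)
  obtain \<psi> where \<psi>: "linear \<psi>" "\<And>v. \<psi> (v - W p v) = B y' v" "\<psi> y' = B y' y' / 2"
    "\<And>p1 p2 x. p = p1 @ p2 \<Longrightarrow> y' \<in> span (set p2) \<Longrightarrow> x \<in> set p1 \<Longrightarrow> \<psi> x = 0"
    "(\<forall>x\<in>set p. \<psi> x = 0) \<Longrightarrow> y' = 0"
  proof -
    have "\<forall>b\<in>set p. B b b = 2" "distinct p" using Cons.prems by auto
    from Cons.IH[OF this(2) indp this(1) r] obtain \<psi> where \<psi>: "linear \<psi>"
      "\<forall>v. \<psi> (v - W p v) = B y' v" "\<psi> y' = B y' y' / 2"
      "\<forall>p1 p2. p = p1 @ p2 \<and> y' \<in> span (set p2) \<longrightarrow> (\<forall>x\<in>set p1. \<psi> x = 0)"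
      "(\<forall>x\<in>set p. \<psi> x = 0) \<longrightarrow> y' = 0"
      unfolding y'_def[symmetric] by (elim exE conjE)
    show thesis by (rule that[of \<psi>]) (use \<psi> in blast)+
  qed
  \<comment> \<open>E(y, x) is \<open>r\<close> times E(a, x) plus E(y', x), and E(a, x) = B(a, x)
    for \<open>x\<close> in the tail \<open>p\<close>. The \<open>\<eta>\<close> term corrects the
    value at \<open>a\<close> to \<open>r\<close>, because E(a, a) = 1 and E(y', a) = 0.\<close>
  define \<phi> where "\<phi> x = \<psi> x + r * B a x + \<eta> x * (r - \<psi> a - 2 * r)" for x
  have lin: "linear \<phi>"
    unfolding \<phi>_def using \<psi>(1) \<eta>(1)
    by (intro linearI) (simp_all add: linear_add linear_scale algebra_simps)
  have \<phi>a: "\<phi> a = r" by (simp add: \<phi>_def \<eta>(2) aa)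
  have \<phi>p: "\<phi> x = \<psi> x + r * B a x" if "x \<in> span (set p)" for x
    by (simp add: \<phi>_def \<eta>(3)[OF that])
  have 1: "\<phi> (v - W (a # p) v) = B y v" for v
  proof -
    have "v - W (a # p) v = (v - W p v) + B a (W p v) *\<^sub>R a" by (simp add: refl_map_def)
    then have "\<phi> (v - W (a # p) v) = \<phi> (v - W p v) + B a (W p v) * r"
      by (simp only: linear_add[OF lin] linear_scale[OF lin] \<phi>a real_scaleR_def)
    also have "\<dots> = B y' v + r * B a v"
      by (simp add: \<phi>p[OF W_diff_in_span] \<psi>(2) algebra_simps)
    finally show ?thesis by (simp add: y)
  qed
  have "\<phi> y = r * r + (\<psi> y' + r * B a y')"
    unfolding y using \<phi>p[of y'] r[folded y'_def]
    by (simp only: linear_add[OF lin] linear_scale[OF lin] \<phi>a real_scaleR_def)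
  then have 2: "\<phi> y = B y y / 2"
    unfolding \<psi>(3) by (simp add: y aa sym[of y' a] field_simps)
  have r0: "r = 0" if "y \<in> span (set p)"
  proof (rule ccontr)
    assume "r \<noteq> 0"
    have "r *\<^sub>R a \<in> span (set p)" using span_diff[OF that r] by simp
    then have "inverse r *\<^sub>R r *\<^sub>R a \<in> span (set p)" by (rule span_scale)
    then show False using \<open>r \<noteq> 0\<close> anot by simp
  qed
  have 3: "\<phi> x = 0" if h: "a # p = p1 @ p2" "y \<in> span (set p2)" "x \<in> set p1" for p1 p2 x
  proof -
    \<comment> \<open>A nonempty \<open>p1\<close> starts with \<open>a\<close>, so \<open>y\<close>
      lies in the span of the tail; then \<open>r = 0\<close> and the claim reduces to
      \<open>\<psi>\<close>.\<close>
    obtain q where q: "p1 = a # q" "p = q @ p2" using h(1,3) by (cases p1) auto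
    have "y \<in> span (set p)" using h(2) span_mono[of "set p2" "set p"] q(2) by auto
    then have "r = 0" by (rule r0)
    then have "y' = y" by (simp add: y'_def)
    show ?thesis
    proof (cases "x = a")
      case True then show ?thesis using \<phi>a \<open>r = 0\<close> by simp
    next
      case False
      then have x: "x \<in> set q" using h(3) q(1) by simp
      then have "\<phi> x = \<psi> x" using \<phi>p[of x] \<open>r = 0\<close> q(2) by (simp add: span_base)
      then show ?thesis using \<psi>(4)[OF q(2) _ x] h(2) \<open>y' = y\<close> by simp
    qed
  qed
  have 4: "y = 0" if "\<forall>x\<in>set (a # p). \<phi> x = 0"
  proof -
    have "r = 0" using that \<phi>a by simp
    then have "\<forall>x\<in>set p. \<psi> x = 0" using that \<phi>p by (auto simp: span_base)
    then show ?thesis using \<psi>(5) \<open>r = 0\<close> by (simp add: y)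
  qed
  show ?case using lin 1 2 3 4 by blast
qed

text \<open>If $x$ and $y$ are non-zero radical vectors in the two spans, then $E(y, \cdot)$ vanishes on
  $R = \langle x, y \rangle$ and on the image of $1 - W$, which together span $V$.  This contradicts
  the nondegeneracy of $E$.\<close>

lemma radical_meets_one_factor:
  assumes "distinct (p @ q)" "independent (set (p @ q))" "\<forall>a\<in>set (p @ q). B a a = 2"
    and fd: "finite (b :: 'a set)" "span b = UNIV"
    and dimR: "dim R = 2"
    and fix_mod: "\<And>v. v - W (p @ q) v \<in> R \<Longrightarrow> v \<in> R"
  shows "span (set p) \<inter> R \<subseteq> {0} \<or> span (set q) \<inter> R \<subseteq> {0}"
proof (rule ccontr)
  assume "\<not> ?thesis"
  then obtain x y where x: "x \<in> span (set p)" "x \<in> R" "x \<noteq> 0"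
    and y: "y \<in> span (set q)" "y \<in> R" "y \<noteq> 0" by blast
  have "span (set q) \<subseteq> span (set (p @ q))" by (intro span_mono) auto
  then have "y \<in> span (set (p @ q))" using y(1) by blast
  from euler_functional[OF assms(1-3) this]
  obtain \<phi> where \<phi>: "linear \<phi>" "\<forall>v. \<phi> (v - W (p @ q) v) = B y v" "\<phi> y = B y y / 2"
    "\<forall>p1 p2. p @ q = p1 @ p2 \<and> y \<in> span (set p2) \<longrightarrow> (\<forall>x\<in>set p1. \<phi> x = 0)"
    "(\<forall>x\<in>set (p @ q). \<phi> x = 0) \<longrightarrow> y = 0"
    by (elim exE conjE)
  have "\<phi> x = 0" by (rule linear_eq_0_on_span[OF \<phi>(1) _ x(1)]) (rule \<phi>(4)[rule_format, OF conjI[OF refl y(1)]])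
  moreover have "\<phi> y = 0" using \<phi>(3) radicalD(1)[OF y(2)] by simp
  moreover have "R \<subseteq> span {x, y}"
  proof (rule card_ge_dim_independent_fd[OF fd])
    \<comment> \<open>Disjoint parts of an independent set: \<open>\<pi>\<close> is the identity on
      one span and zero on the other.\<close>
    have disj: "u = 0" if u: "u \<in> span (set p)" "u \<in> span (set q)" for u
    proof -
      obtain \<pi> where \<pi>: "linear \<pi>" "\<forall>v\<in>set (p @ q). \<pi> v = (if v \<in> set p then v else 0)"
        using linear_independent_extend[OF assms(2), of "\<lambda>v. if v \<in> set p then v else 0"] by auto
      have "\<pi> u = u"
        using linear_eq_on_span[OF \<pi>(1) linear_ident, of "set p" u] \<pi>(2) u(1) by auto
      moreover have "\<pi> u = 0"
      proof (rule linear_eq_0_on_span[OF \<pi>(1) _ u(2)])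
        fix x assume "x \<in> set q"
        then show "\<pi> x = 0" using \<pi>(2) assms(1) by auto
      qed
      ultimately show ?thesis by simp
    qed
    have "x \<notin> span {y}"
    proof
      assume "x \<in> span {y}"
      then have "x \<in> span (set q)"
        using span_minimal[of "{y}" "span (set q)"] y(1) by auto
      then show False using disj[of x] x by simp
    qed
    moreover have "x \<noteq> y" using disj x y by blast
    ultimately show "independent {x, y}" "dim R \<le> card {x, y}"
      using y(3) dimR independent_insertI[of x "{y}"] by simp_all
    show "{x, y} \<subseteq> R" using x(2) y(2) by simp
  qed
  ultimately have \<phi>R: "\<phi> u = 0" if "u \<in> R" for u
    using linear_eq_0_on_span[OF \<phi>(1), of "{x, y}" u] that by auto
  have "\<phi> u = 0" for u
  proof -
    obtain \<pi> where \<pi>: "linear \<pi>" "\<And>v. \<pi> v \<in> R" "\<And>v. v \<in> R \<Longrightarrow> \<pi> v = v"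
      by (rule linear_projection_exists[OF subspace_radical]) (rule that)
    \<comment> \<open>Every value of \<open>g\<close> is a sum of a vector in the image of 1 - W and
      a radical vector, and \<open>\<phi>\<close> kills both. Hence surjectivity of \<open>g\<close>
      gives \<open>\<phi> = 0\<close>.\<close>
    define g where "g v = (v - W (p @ q) v) + \<pi> v" for v
    have lin: "linear g"
      unfolding g_def[abs_def]
      by (intro linear_compose_add linear_compose_sub linear_ident linear_W \<pi>(1))
    have "inj g"
    proof (rule linear_injective_0[OF lin, THEN iffD2, rule_format])
      fix v assume v: "g v = 0"
      then have "v - W (p @ q) v = - \<pi> v" unfolding g_def by (rule eq_neg_iff_add_eq_0[THEN iffD2])
      then have "v - W (p @ q) v \<in> R" using subspace_neg[OF subspace_radical \<pi>(2)] by (simp only:)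
      then have vR: "v \<in> R" by (rule fix_mod)
      \<comment> \<open>Reflections fix radical vectors, so \<open>g\<close> is the identity on
        \<open>R\<close>.\<close>
      have "W r v = v" for r
        by (induction r) (simp_all add: refl_map_def radicalD[OF vR])
      then show "v = 0" using v \<pi>(3)[OF vR] by (simp add: g_def)
    qed
    then obtain v where "u = g v"
      using linear_inj_imp_surj_fd[OF fd lin] by (metis surjD)
    then show ?thesis
      by (simp only: g_def linear_add[OF \<phi>(1)] \<phi>(2)[rule_format] \<phi>R[OF \<pi>(2)]
          radicalD(1)[OF y(2)] add_0_left)
  qed
  then show False using \<phi>(5) y(3) by blast
qed

end

section \<open>Generating sets of roots\<close>

context psd_form
begin

text \<open>Otherwise every root not orthogonal to \<open>a\<close> pairs with it to 2 or -2 and so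
  equals \<open>a\<close> or \<open>- a\<close> modulo the radical. The roots orthogonal to
  \<open>a\<close> then split off, so by irreducibility there are none. Hence \<open>x\<close> is
  \<open>a\<close> up to sign modulo the radical, and \<open>B x y = -1\<close> makes
  \<open>a\<close> pair with \<open>y\<close> to 1 or -1 after all.\<close>

lemma ex_root_with_unit_pairing:
  assumes norm: "\<forall>a\<in>\<Phi>. B a a = 2" and int: "\<forall>a\<in>\<Phi>. \<forall>b\<in>\<Phi>. B a b \<in> \<int>"
    and irr: "irreducible_roots B \<Phi>"
    and xy: "x \<in> \<Phi>" "y \<in> \<Phi>" "B x y = -1"
    and a: "a \<in> \<Phi>"
  shows "\<exists>v\<in>\<Phi>. B a v = 1 \<or> B a v = -1"
proof (rule ccontr)
  assume none: "\<not> ?thesis"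
  have two: "(\<forall>u. B v u = B a u) \<or> (\<forall>u. B v u = - B a u)" if v: "v \<in> \<Phi>" "B a v \<noteq> 0" for v
  proof -
    have "B a v \<in> \<int>" using int a v(1) by blast
    then obtain k where k: "B a v = of_int k" by (auto elim: Ints_cases)
    have plus: "B (v + a) (v + a) = 4 + 2 * of_int k" and minus: "B (v - a) (v - a) = 4 - 2 * of_int k"
      using norm a v(1) k sym[of v a] by auto
    then have "4 + 2 * real_of_int k \<ge> 0" "4 - 2 * real_of_int k \<ge> 0"
      using nonneg[of "v + a"] nonneg[of "v - a"] by auto
    moreover have "k \<noteq> 0" "k \<noteq> 1" "k \<noteq> -1" using v none k by auto
    ultimately have "k = 2 \<or> k = -2" by auto
    then have "B (v - a) (v - a) = 0 \<or> B (v + a) (v + a) = 0"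
      unfolding plus minus by auto
    then have "v - a \<in> R \<or> v + a \<in> R"
      using isotropic_imp_radical by blast
    then have "(\<forall>u. B (v - a) u = 0) \<or> (\<forall>u. B (v + a) u = 0)"
      using radicalD(1) by blast
    then show ?thesis by (simp add: add_eq_0_iff2)
  qed
  let ?P = "{v \<in> \<Phi>. B a v \<noteq> 0}" and ?Q = "{v \<in> \<Phi>. B a v = 0}"
  have "B a a = 2" using a norm by blast
  then have P: "?P \<noteq> {}" using a by auto
  have orth: "B v u = 0" if "v \<in> ?P" "u \<in> ?Q" for v u
    using two[of v] that by auto
  have "?Q = {}"
  proof (rule ccontr)
    assume "?Q \<noteq> {}"
    then have "?P \<noteq> {} \<and> ?Q \<noteq> {} \<and> \<Phi> = ?P \<union> ?Q \<and> (\<forall>v\<in>?P. \<forall>u\<in>?Q. B v u = 0)"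
      using P orth by (intro conjI ballI) (assumption | blast)+
    then show False using irr unfolding irreducible_roots_def by (meson notE)
  qed
  then have xa: "B a x \<noteq> 0" using xy(1) by blast
  have "B x y = B a y \<or> B x y = - B a y" using two[OF xy(1) xa] by metis
  then have "B a y = 1 \<or> B a y = -1" unfolding xy(3) by (elim disjE) simp_all
  then show False using none xy(2) by blast
qed

text \<open>A reflection in a root of \<open>p\<close> shifts lattice vectors by integer multiples
  of that root. The shifts of a product add up, as intermediate images stay in
  \<open>int_span \<Phi>\<close>.\<close>

lemma generate_diff_in_int_span:
  assumes norm: "\<forall>a\<in>\<Phi>. B a a = 2" and int: "\<forall>a\<in>\<Phi>. \<forall>b\<in>\<Phi>. B a b \<in> \<int>"
    and p: "set p \<subseteq> \<Phi>" and w: "w \<in> G p" and v: "v \<in> int_span \<Phi>"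
  shows "w v - v \<in> int_span (set p)"
proof -
  interpret GL: group "GL_V :: ('a \<Rightarrow> 'a) monoid" by (rule group_GL_V)
  have refl: "s a u - u \<in> int_span (set p)" if a: "a \<in> set p" and u: "u \<in> int_span \<Phi>" for a u
  proof -
    have "int_span \<Phi> \<subseteq> {u. B a u \<in> \<int>}"
      using int a p by (intro int_span_minimal) auto
    then have "B a u \<in> \<int>" using u by blast
    then obtain k where "B a u = of_int k" by (auto elim: Ints_cases)
    then have "s a u - u = of_int (- k) *\<^sub>R a" by (simp add: refl_map_def)
    then show ?thesis using int_span_scale[OF base_in_int_span[OF a]] by metis
  qed
  have sub: "int_span (set p) \<subseteq> int_span \<Phi>"
    using p by (intro int_span_mono) (auto intro: base_in_int_span)
  show ?thesis using w v
  proof (induction arbitrary: v rule: generate.induct)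
    case one then show ?case by (simp add: GL_V_def zero_in_int_span)
  next
    case (incl f) then show ?case using refl by auto
  next
    case (inv f)
    then obtain a where a: "f = s a" "a \<in> set p" by auto
    then have "B a a = 2" using norm p by auto
    then have "inv\<^bsub>GL_V\<^esub> f = f"
      using refl_in_GL[of a] refl_refl[of a]
      by (intro GL.inv_equality) (auto simp: a(1) GL_V_def fun_eq_iff)
    then show ?case using refl inv a by auto
  next
    case (eng f g)
    have g: "g v - v \<in> int_span (set p)" using eng by blast
    then have "g v \<in> int_span \<Phi>" using sub eng.prems int_span_add[of "g v - v" \<Phi> v] by auto
    then have "f (g v) - g v \<in> int_span (set p)" using eng by blast
    from int_span_add[OF this g] show ?case by (simp add: GL_V_def)
  qed
qed

text \<open>For every root \<open>a\<close>, the reflection \<open>s a\<close> lies in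
  \<open>G p\<close> and moves a root with pairing 1 or -1 by exactly \<open>a\<close> up to sign.
  So \<open>a\<close> lies in the lattice spanned by \<open>p\<close>.\<close>

lemma int_span_eq_if_generate:
  assumes norm: "\<forall>a\<in>\<Phi>. B a a = 2" and int: "\<forall>a\<in>\<Phi>. \<forall>b\<in>\<Phi>. B a b \<in> \<int>"
    and irr: "irreducible_roots B \<Phi>"
    and xy: "x \<in> \<Phi>" "y \<in> \<Phi>" "B x y = -1"
    and p: "set p \<subseteq> \<Phi>" and gen: "G p = weyl_group B \<Phi>"
  shows "int_span (set p) = int_span \<Phi>"
proof
  show "int_span (set p) \<subseteq> int_span \<Phi>"
    using p by (intro int_span_mono) (auto intro: base_in_int_span)
  show "int_span \<Phi> \<subseteq> int_span (set p)"
  proof (rule int_span_mono, rule subsetI)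
    fix a assume a: "a \<in> \<Phi>"
    obtain v where v: "v \<in> \<Phi>" "B a v = 1 \<or> B a v = -1"
      using ex_root_with_unit_pairing[OF norm int irr xy a] by blast
    have "s a \<in> G p"
      unfolding gen weyl_group_def reflections_def using a by (intro generate.incl) auto
    from generate_diff_in_int_span[OF norm int p this base_in_int_span[OF v(1)]]
    have "a \<in> int_span (set p) \<or> - a \<in> int_span (set p)"
      using v(2) by (auto simp: refl_map_def)
    then show "a \<in> int_span (set p)" using int_span_minus by force
  qed
qed

section \<open>The Coxeter transformation modulo the radical\<close>

lemma coset_eqD:
  assumes "subspace U" "coset U x = coset U y"
  shows "x - y \<in> U"
proof -
  have "x \<in> coset U x" by (simp add: coset_def subspace_0[OF assms(1)])
  then show ?thesis unfolding assms(2) by (simp add: coset_def)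
qed

lemma coset_eq_zeroI:
  assumes "subspace U" "x \<in> U"
  shows "coset U x = coset U 0"
proof -
  have "w - x \<in> U \<longleftrightarrow> w \<in> U" for w
    using subspace_add[OF assms(1) _ assms(2), of "w - x"] subspace_diff[OF assms(1) _ assms(2), of w]
    by auto
  then show ?thesis by (simp add: coset_def)
qed

text \<open>Modulo the radical the last two reflections cancel, and the other roots
  \<open>\<alpha> j\<close> are independent there. A vector fixed modulo \<open>R\<close> is thus
  orthogonal to these, and also to \<open>\<alpha> t\<close>, because the radical vector
  \<open>d\<close> has a positive coefficient at \<open>t\<close>.\<close>

lemma coxeter_fixed_mod_radical:
  assumes cox: "coxeter_transformation B \<Phi> n c" and norm: "\<forall>a\<in>\<Phi>. B a a = 2" and spanning: "span \<Phi> = UNIV"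
    and dimR: "dim R = 2" and fd: "finite (b :: 'a set)" "span b = UNIV"
    and fixed: "v - c v \<in> R"
  shows "v \<in> R"
proof -
  obtain \<alpha> t a js where basis: "elliptic_root_basis B \<Phi> n \<alpha> t a"
    and js: "distinct js" "set js = {0..n} - {t}"
    and c: "c = word_prod (map (\<lambda>j. s (\<alpha> j)) js) \<circ> s (\<alpha> t) \<circ> s (\<alpha> t + a)"
    using cox unfolding coxeter_transformation_def by (elim exE conjE)
  obtain U m where U: "subspace U" "dim U = 1" "U \<subseteq> R"
    and aU: "int_span \<Phi> \<inter> U = range (\<lambda>z::int. of_int z *\<^sub>R a)"
    and roots: "\<forall>i\<in>{0..n}. \<alpha> i \<in> \<Phi>"
    and simp_sys: "simple_system U (coset U ` \<Phi>) {0..n} \<alpha>"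
    and mpos: "\<forall>i\<in>{1..n}. m i > 0"
    and \<delta>: "coset U ` int_span (\<alpha> ` {0..n}) \<inter> coset U ` R
             = range (\<lambda>z::int. coset U (of_int z *\<^sub>R (\<alpha> 0 + (\<Sum>i\<in>{1..n}. of_nat (m i) *\<^sub>R \<alpha> i))))"
    and t: "t \<in> {1..n}"
    using basis unfolding elliptic_root_basis_def Let_def by (elim exE conjE) (rule that; assumption)
  have mt: "m t > 0" using t mpos by blast
  define M where "M i = (if i = 0 then 1 else real (m i))" for i
  define d where "d = (\<Sum>i\<in>{0..n}. M i *\<^sub>R \<alpha> i)"
  have d: "d = \<alpha> 0 + (\<Sum>i\<in>{1..n}. of_nat (m i) *\<^sub>R \<alpha> i)"
    unfolding d_def M_def by (subst sum.atLeast_Suc_atMost) (auto intro!: sum.cong)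
  have indep: "z i = 0" if "(\<Sum>i\<in>{0..n}. z i *\<^sub>R \<alpha> i) \<in> U" "i \<in> {0..n}" for z i
    using simp_sys coset_eq_zeroI[OF U(1) that(1)] that(2) unfolding simple_system_def by blast
  \<comment> \<open>The generator belongs to the intersection it generates, so it is radical modulo
    \<open>U\<close>, hence radical.\<close>
  have "coset U d \<in> range (\<lambda>z::int. coset U (of_int z *\<^sub>R d))"
    by (rule range_eqI[of _ _ 1]) simp
  then have "coset U d \<in> coset U ` R" unfolding \<delta>[folded d, symmetric] by (rule IntD2)
  then obtain r where "r \<in> R" "coset U d = coset U r" by (elim imageE)
  then have dR: "d \<in> R"
    using coset_eqD[OF U(1), of d r] U(3) subspace_add[OF subspace_radical, of "d - r" r] by auto
  \<comment> \<open>The coefficient of \<open>d\<close> at 0 is 1, and simple roots are independent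
    modulo \<open>U\<close>. So \<open>d\<close> and a nonzero \<open>e\<close> in \<open>U\<close>
    will form a basis of the radical.\<close>
  have dU: "d \<notin> U" using indep[of M 0] by (auto simp: d_def M_def)
  have "a = of_int 1 *\<^sub>R a" by simp
  then have "a \<in> range (\<lambda>z::int. of_int z *\<^sub>R a)" by (rule range_eqI)
  then have aR: "a \<in> R" using aU U(3) by blast
  have "dim {0 :: 'a} = dim ({} :: 'a set)" by (rule span_eq_dim) simp
  then have "dim {0 :: 'a} = 0" using dim_eq_card_independent[OF independent_empty] by simp
  then have "U \<noteq> {0}" using U(2) by auto
  then obtain e where e: "e \<in> U" "e \<noteq> 0" using subspace_0[OF U(1)] by blast
  have "span {e} \<subseteq> U" using e(1) U(1) by (intro span_minimal) auto
  then have "d \<notin> span {e}" using dU by blast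
  then have "independent {d, e}"
    using independent_insertI[of d "{e}"] e(2) by simp
  moreover have "d \<noteq> e" using dU e(1) by blast
  ultimately have de: "independent {d, e}" "card {d, e} = 2" by simp_all
  then have Rspan: "R \<subseteq> span {d, e}"
    using card_ge_dim_independent_fd[OF fd, of "{d, e}" R] de dR e(1) U(3) dimR by auto
  \<comment> \<open>A relation modulo \<open>R\<close> is a relation modulo \<open>U\<close> up to a
    multiple \<open>y\<close> of \<open>d\<close>. Its coefficient at \<open>t\<close> comes from
    \<open>d\<close> alone, which forces \<open>y = 0\<close>.\<close>
  have no: "\<alpha> j \<notin> span (R \<union> \<alpha> ` F)" if F: "F \<subseteq> {0..n} - {t}" "j \<in> {0..n} - {t}" "j \<notin> F" for j F
  proof
    assume "\<alpha> j \<in> span (R \<union> \<alpha> ` F)"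
    then obtain r' x' where rx: "r' \<in> R" "x' \<in> span (\<alpha> ` F)" "\<alpha> j = r' + x'"
      unfolding span_Un span_eq_iff[THEN iffD2, OF subspace_radical] by auto
    have finF: "finite F" using F(1) finite_subset by blast
    have "span (\<alpha> ` F) \<subseteq> range (\<lambda>x. \<Sum>i\<in>F. x i *\<^sub>R \<alpha> i)"
    proof (rule span_minimal)
      show "\<alpha> ` F \<subseteq> range (\<lambda>x. \<Sum>i\<in>F. x i *\<^sub>R \<alpha> i)"
      proof
        fix u assume "u \<in> \<alpha> ` F"
        then obtain i where i: "i \<in> F" "u = \<alpha> i" by auto
        then have "u = (\<Sum>k\<in>F. (if k = i then 1 else 0) *\<^sub>R \<alpha> k)"
          using finF by (simp add: if_distrib[of "\<lambda>r. r *\<^sub>R _"] cong: if_cong)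
        then show "u \<in> range (\<lambda>x. \<Sum>i\<in>F. x i *\<^sub>R \<alpha> i)"
          by (rule range_eqI[of _ _ "\<lambda>k. if k = i then 1 else 0"])
      qed
      show "subspace (range (\<lambda>x. \<Sum>i\<in>F. x i *\<^sub>R \<alpha> i))"
        unfolding subspace_def
      proof (intro conjI allI ballI)
        show "0 \<in> range (\<lambda>x. \<Sum>i\<in>F. x i *\<^sub>R \<alpha> i)"
          by (rule range_eqI[of _ _ "\<lambda>_. 0"]) simp
      next
        fix u w assume "u \<in> range (\<lambda>x. \<Sum>i\<in>F. x i *\<^sub>R \<alpha> i)" "w \<in> range (\<lambda>x. \<Sum>i\<in>F. x i *\<^sub>R \<alpha> i)"
        then obtain x y where "u = (\<Sum>i\<in>F. x i *\<^sub>R \<alpha> i)" "w = (\<Sum>i\<in>F. y i *\<^sub>R \<alpha> i)" by auto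
        then show "u + w \<in> range (\<lambda>x. \<Sum>i\<in>F. x i *\<^sub>R \<alpha> i)"
          by (intro range_eqI[of _ _ "\<lambda>i. x i + y i"]) (simp add: scaleR_left_distrib sum.distrib)
      next
        fix k u assume "u \<in> range (\<lambda>x. \<Sum>i\<in>F. x i *\<^sub>R \<alpha> i)"
        then obtain x where "u = (\<Sum>i\<in>F. x i *\<^sub>R \<alpha> i)" by auto
        then show "k *\<^sub>R u \<in> range (\<lambda>x. \<Sum>i\<in>F. x i *\<^sub>R \<alpha> i)"
          by (intro range_eqI[of _ _ "\<lambda>i. k * x i"]) (simp add: scaleR_sum_right)
      qed
    qed
    then obtain x where x: "x' = (\<Sum>i\<in>F. x i *\<^sub>R \<alpha> i)" using rx(2) by blast
    obtain y y' where "r' = y *\<^sub>R d + y' *\<^sub>R e"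
      using rx(1) Rspan by (auto simp: span_insert span_singleton algebra_simps)
    then have "\<alpha> j - x' - y *\<^sub>R d = y' *\<^sub>R e" using rx(3) by simp
    then have inU: "\<alpha> j - x' - y *\<^sub>R d \<in> U" using subspace_scale[OF U(1) e(1)] by simp
    define z where "z i = (if i = j then 1 else 0) - (if i \<in> F then x i else 0) - y * M i" for i
    have "\<alpha> j = (\<Sum>i\<in>{0..n}. (if i = j then 1 else 0) *\<^sub>R \<alpha> i)"
      using F(2) by (simp add: if_distrib[of "\<lambda>r. r *\<^sub>R _"] cong: if_cong)
    moreover have "x' = (\<Sum>i\<in>{0..n}. (if i \<in> F then x i else 0) *\<^sub>R \<alpha> i)"
      unfolding x using F(1) by (intro sum.mono_neutral_cong_left) auto
    ultimately have "\<alpha> j - x' - y *\<^sub>R d = (\<Sum>i\<in>{0..n}. z i *\<^sub>R \<alpha> i)"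
      unfolding z_def d_def by (simp only: scaleR_left_diff_distrib sum_subtractf scaleR_sum_right scaleR_scaleR)
    then have z: "z i = 0" if "i \<in> {0..n}" for i using indep[of z i] inU that by simp
    have "z t = - y * real (m t)" using F t by (auto simp: z_def M_def)
    then have "y = 0" using z[of t] t mt by auto
    then have "z j = 1" using F(3) by (simp add: z_def)
    then show False using z[of j] F(2) by simp
  qed
  have J: "indep_mod R (map \<alpha> ks)" if "distinct ks" "set ks \<subseteq> {0..n} - {t}" for ks
    using that
  proof (induction ks)
    case (Cons k ks)
    then show ?case using no[of "set ks" k] by simp
  qed simp
  define u where "u = s (\<alpha> t) (s (\<alpha> t + a) v)"
  have "\<alpha> t \<in> \<Phi>" using roots t by auto
  then have "B (\<alpha> t) (\<alpha> t) = 2" using norm by blast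
  \<comment> \<open>The product of the two reflections only shifts along the radical vector
    \<open>a\<close>.\<close>
  then have u: "u = v - B (\<alpha> t) v *\<^sub>R a"
    by (simp add: u_def refl_map_def radicalD[OF aR] algebra_simps)
  have cv: "c v = W (map \<alpha> js) u"
    by (simp add: c u_def W_def o_def)
  have "B (\<alpha> t) v *\<^sub>R a \<in> R" using subspace_scale[OF subspace_radical aR] .
  then have "u - W (map \<alpha> js) u \<in> R"
    using subspace_diff[OF subspace_radical fixed, of "B (\<alpha> t) v *\<^sub>R a"] unfolding cv u
    by (simp add: algebra_simps)
  then have "u - W (map \<alpha> js) u \<in> span R" by (rule span_base)
  have ort: "B (\<alpha> j) v = 0" if "j \<in> {0..n} - {t}" for j
  proof -
    have "B (\<alpha> j) u = 0"
      using J[OF js(1)] js(2) \<open>u - W (map \<alpha> js) u \<in> span R\<close> that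
      by (intro orthogonal_if_fixed[of R "map \<alpha> js"]) simp_all
    then show ?thesis by (simp add: u radicalD[OF aR])
  qed
  have form_sum: "B (\<Sum>i\<in>{0..n}. z i *\<^sub>R \<alpha> i) v = (\<Sum>i\<in>{0..n}. z i * B (\<alpha> i) v)" for z :: "nat \<Rightarrow> real"
  proof -
    have "B v (\<Sum>i\<in>{0..n}. z i *\<^sub>R \<alpha> i) = (\<Sum>i\<in>{0..n}. z i * B v (\<alpha> i))"
      by (simp add: linear_sum[OF linear_form])
    then show ?thesis by (simp only: sym[of v])
  qed
  \<comment> \<open>Pairing \<open>d\<close> with \<open>v\<close> leaves only the term at
    \<open>t\<close>, whose coefficient is nonzero.\<close>
  have "(\<Sum>i\<in>{0..n}. M i * B (\<alpha> i) v) = 0"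
    using radicalD(1)[OF dR, of v] form_sum[of M] by (simp add: d_def)
  also have "(\<Sum>i\<in>{0..n}. M i * B (\<alpha> i) v) = (\<Sum>i\<in>{t}. M i * B (\<alpha> i) v)"
    using ort t by (intro sum.mono_neutral_right) auto
  finally have "B (\<alpha> t) v = 0" using t mt by (auto simp: M_def)
  then have ort': "B (\<alpha> j) v = 0" if "j \<in> {0..n}" for j
    using ort[of j] that by (cases "j = t") simp_all
  \<comment> \<open>Modulo \<open>U\<close> each root is a combination of the
    \<open>\<alpha> i\<close>, and the roots span the space.\<close>
  have "B v x = 0" if "x \<in> \<Phi>" for x
  proof -
    have "coset U x \<in> coset U ` \<Phi>" using that by (rule imageI)
    with simp_sys have "\<exists>k :: nat \<Rightarrow> int. coset U x = coset U (\<Sum>i\<in>{0..n}. of_int (k i) *\<^sub>R \<alpha> i) \<and>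
        ((\<forall>i\<in>{0..n}. k i \<ge> 0) \<or> (\<forall>i\<in>{0..n}. k i \<le> 0))"
      unfolding simple_system_def by (elim conjE) (rule bspec)
    then obtain k :: "nat \<Rightarrow> int" where k: "coset U x = coset U (\<Sum>i\<in>{0..n}. of_int (k i) *\<^sub>R \<alpha> i)"
      by (elim exE conjE)
    have "x - (\<Sum>i\<in>{0..n}. of_int (k i) *\<^sub>R \<alpha> i) \<in> R" using coset_eqD[OF U(1) k] U(3) by (rule rev_subsetD)
    from radicalD(1)[OF this, of v]
    have "B x v = B (\<Sum>i\<in>{0..n}. of_int (k i) *\<^sub>R \<alpha> i) v" by simp
    also have "\<dots> = 0" unfolding form_sum by (intro sum.neutral ballI) (simp add: ort')
    finally show ?thesis unfolding sym[of v x] .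
  qed
  then have "B v x = 0" for x
    using linear_eq_0_on_span[OF linear_form[of v], of \<Phi> x] unfolding spanning by simp
  then show ?thesis by (simp add: radical_def)
qed

end

section \<open>Rigidity\<close>

context psd_form
begin

text \<open>Comes from two adjacent nodes of the Dynkin diagram. The \<open>\<gamma> k\<close> are
  roots only modulo the radical, which the form does not see.\<close>

lemma fin_type_unit_pairing:
  assumes "fin_type B \<Phi> X"
  obtains x y where "x \<in> \<Phi>" "y \<in> \<Phi>" "B x y = -1"
proof -
  obtain \<gamma> where \<gamma>: "simple_system R (coset R ` \<Phi>) {1..type_rank X} \<gamma>"
    "\<forall>i\<in>{1..type_rank X}. \<forall>j\<in>{1..type_rank X}.
       B (\<gamma> i) (\<gamma> j) = (if i = j then 2 else if {i, j} \<in> type_edges X then -1 else 0)"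
    using assms unfolding fin_type_def by (elim exE conjE)
  obtain i j where ij: "i \<in> {1..type_rank X}" "j \<in> {1..type_rank X}" "i \<noteq> j" "{i, j} \<in> type_edges X"
  proof (cases X)
    case D4 then show thesis by (intro that[of 1 2]) simp_all
  qed (intro that[of 1 3]; simp)+
  have rep: "\<exists>x\<in>\<Phi>. \<gamma> k - x \<in> R" if "k \<in> {1..type_rank X}" for k
  proof -
    have "\<forall>k\<in>{1..type_rank X}. coset R (\<gamma> k) \<in> coset R ` \<Phi>"
      using \<gamma>(1) unfolding simple_system_def by (elim conjE)
    then have "coset R (\<gamma> k) \<in> coset R ` \<Phi>" using that by (rule bspec)
    then obtain x where "coset R (\<gamma> k) = coset R x" "x \<in> \<Phi>" by (elim imageE)
    then show ?thesis using coset_eqD[OF subspace_radical] by metis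
  qed
  obtain x y where xy: "x \<in> \<Phi>" "\<gamma> i - x \<in> R" "y \<in> \<Phi>" "\<gamma> j - y \<in> R"
    using rep[OF ij(1)] rep[OF ij(2)] by (elim bexE)
  have "B (\<gamma> i) (\<gamma> j) = -1" using \<gamma>(2) ij by simp
  moreover have "B (\<gamma> i) (\<gamma> j) = B x (\<gamma> j)" using radicalD(1)[OF xy(2), of "\<gamma> j"] by simp
  moreover have "B x (\<gamma> j) = B x y" using radicalD(2)[OF xy(4), of x] by simp
  ultimately show thesis using that[OF xy(1,3)] by simp
qed

text \<open>If the span of \<open>p1\<close> avoids the radical, \<open>q1\<close> is exchanged for
  \<open>p1\<close> in the generating list \<open>q1 @ q2\<close>. Otherwise the span of
  \<open>p2\<close> does, and \<open>p2\<close> is exchanged for \<open>q2\<close> in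
  \<open>p1 @ p2\<close>.\<close>

lemma rigidity:
  assumes norm: "\<forall>a\<in>\<Phi>. B a a = 2" and int: "\<forall>a\<in>\<Phi>. \<forall>b\<in>\<Phi>. B a b \<in> \<int>"
    and irr: "irreducible_roots B \<Phi>" and X: "fin_type B \<Phi> X"
    and spanning: "span \<Phi> = UNIV" and dimR: "dim R = 2"
    and fd: "finite (b :: 'a set)" "span b = UNIV"
    and dimV: "dim (UNIV :: 'a set) = length (p1 @ p2)"
    and len: "length q1 = length p1" "length q2 = length p2"
    and roots: "set (p1 @ p2) \<subseteq> \<Phi>" "set (q1 @ q2) \<subseteq> \<Phi>"
    and gen: "G (p1 @ p2) = weyl_group B \<Phi>" "G (q1 @ q2) = weyl_group B \<Phi>"
    and eq: "W p1 = W q1" "W p2 = W q2"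
    and fix_mod: "\<And>v. v - W (p1 @ p2) v \<in> R \<Longrightarrow> v \<in> R"
  shows "weyl_group B \<Phi> \<subseteq> G (p1 @ q2)"
proof -
  obtain x y where xy: "x \<in> \<Phi>" "y \<in> \<Phi>" "B x y = -1" by (rule fin_type_unit_pairing[OF X])
  \<comment> \<open>Generating lists span the lattice, hence the space; as their length is the
    dimension, they are bases without repetition.\<close>
  have basis: "int_span (set p) = int_span \<Phi> \<and> independent (set p) \<and> distinct p"
    if p: "set p \<subseteq> \<Phi>" "G p = weyl_group B \<Phi>" "length p = dim (UNIV :: 'a set)" for p
  proof -
    have L: "int_span (set p) = int_span \<Phi>" by (rule int_span_eq_if_generate[OF norm int irr xy p(1,2)])
    then have "\<Phi> \<subseteq> span (set p)"
      using base_in_int_span[of _ \<Phi>] int_span_subset_span[of "set p"] by blast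
    then have sp: "span (set p) = UNIV"
      using span_minimal[of \<Phi> "span (set p)"] spanning by auto
    then have "dim (UNIV :: 'a set) \<le> card (set p)" by (intro dim_le_card) auto
    then have "card (set p) = length p" using card_length[of p] p(3) by simp
    then have "distinct p" "independent (set p)"
      using card_le_dim_spanning_fd[OF fd sp] p(3) by (auto intro: card_distinct)
    then show ?thesis using L by simp
  qed
  have bp: "int_span (set (p1 @ p2)) = int_span \<Phi>" "independent (set (p1 @ p2))" "distinct (p1 @ p2)"
    using basis[OF roots(1) gen(1)] dimV by simp_all
  have bq: "int_span (set (q1 @ q2)) = int_span \<Phi>" "independent (set (q1 @ q2))" "distinct (q1 @ q2)"
    using basis[OF roots(2) gen(2)] dimV len by simp_all
  have transfer: "a \<in> int_span (set p')"
    if "independent (set p)" "set p' \<subseteq> set p" "int_span (set p) = int_span \<Phi>"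
      "a \<in> \<Phi>" "a \<in> span (set p')" for p p' a
    using int_span_Int_span[OF that(1,2)] base_in_int_span[OF that(4)] that(3,5) by simp
  have ind: "independent (set p1)" "independent (set p2)" "independent (set q1)" "independent (set q2)"
    by (rule independent_mono[OF bp(2)] independent_mono[OF bq(2)], simp)+
  have GL: "\<forall>f\<in>s ` set p. f \<in> carrier GL_V" if "set p \<subseteq> \<Phi>" for p
    using that norm refl_in_GL by auto
  have sub: "set p1 \<subseteq> \<Phi>" "set p2 \<subseteq> \<Phi>" "set q1 \<subseteq> \<Phi>" "set q2 \<subseteq> \<Phi>" using roots by auto
  have norm': "\<forall>a\<in>set p. B a a = 2" "\<forall>a\<in>set p. \<forall>b\<in>set p. B a b \<in> \<int>" if "set p \<subseteq> \<Phi>" for p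
    using that norm int by blast+
  consider "span (set p1) \<inter> R \<subseteq> {0}" | "span (set p2) \<inter> R \<subseteq> {0}"
    using radical_meets_one_factor[OF bp(3,2) norm'(1)[OF roots(1)] fd dimR fix_mod] by blast
  then show ?thesis
  proof cases
    case 1
    have "span (set p1) = span (set q1)"
      using span_eq_if_W_eq[OF _ ind(1) 1 fd eq(1) len(1)] bp(3) by simp
    then have "a \<in> int_span (set p1)" if "a \<in> set q1" for a
      using transfer[OF bp(2) _ bp(1), of p1 a] that sub(3) by (auto intro: span_base)
    then have "\<forall>a\<in>set q1. B a a = 2 \<and> a \<in> int_span (set p1)" using norm'(1)[OF sub(3)] by blast
    from generate_mix[OF norm'[OF sub(1)] this 1 GL[OF sub(4)]]
    show ?thesis by (simp add: gen(2)[symmetric] image_Un)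
  next
    case 2
    have eqs: "span (set p2) = span (set q2)"
      using span_eq_if_W_eq[OF _ ind(2) 2 fd eq(2) len(2)] bp(3) by simp
    then have "a \<in> int_span (set q2)" if "a \<in> set p2" for a
      using transfer[OF bq(2) _ bq(1), of q2 a] that sub(2) by (auto intro: span_base)
    then have "\<forall>a\<in>set p2. B a a = 2 \<and> a \<in> int_span (set q2)" using norm'(1)[OF sub(2)] by blast
    \<comment> \<open>Here \<open>q2\<close> is the generating side, so the condition on the radical
      is carried over to its span by \<open>eqs\<close>.\<close>
    from generate_mix[OF norm'[OF sub(4)] this 2[unfolded eqs] GL[OF sub(1)]]
    show ?thesis by (simp add: gen(1)[symmetric] image_Un Un_commute)
  qed
qed

end

theorem theorem7p2:
  fixes B :: "'a::real_vector \<Rightarrow> 'a \<Rightarrow> real" and \<Phi> :: "'a set"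
    and n :: nat and c :: "'a \<Rightarrow> 'a"
  assumes "tubular_root_system B \<Phi>"
    and "dim (UNIV :: 'a set) = n + 2"
    and "coxeter_transformation B \<Phi> n c"
  shows "\<forall>ts \<in> Red_gen B \<Phi> n c. \<forall>rs \<in> Red_gen B \<Phi> n c. \<forall>h.
           1 \<le> h \<and> h \<le> n \<and> word_prod (take h ts) = word_prod (take h rs)
           \<longrightarrow> take h ts @ drop h rs \<in> Red_gen B \<Phi> n c"
proof (intro ballI allI impI, elim conjE)
  fix ts rs h
  assume ts: "ts \<in> Red_gen B \<Phi> n c" and rs: "rs \<in> Red_gen B \<Phi> n c"
    and h: "h \<le> n" and eq1: "word_prod (take h ts) = word_prod (take h rs)"
  have ell: "elliptic_root_system B \<Phi>" and irr: "irreducible_roots B \<Phi>" and "\<exists>X. fin_type B \<Phi> X"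
    using assms(1) unfolding tubular_root_system_def by blast+
  then obtain X where X: "fin_type B \<Phi> X" by (elim exE)
  obtain b :: "'a set" where fd: "finite b" "span b = UNIV"
    using ell unfolding elliptic_root_system_def by (elim conjE exE)
  have form: "bilinear B" "\<forall>x y. B x y = B y x" "\<forall>x. B x x \<ge> 0"
    and dimR: "dim (radical B) = 2" and norm: "\<forall>\<alpha>\<in>\<Phi>. B \<alpha> \<alpha> = 2"
    and spanning: "span \<Phi> = UNIV" and int: "\<forall>\<alpha>\<in>\<Phi>. \<forall>\<beta>\<in>\<Phi>. B \<alpha> \<beta> \<in> \<int>"
    using ell unfolding elliptic_root_system_def by - (elim conjE, assumption)+
  interpret psd_form B using form by unfold_locales simp_all
  interpret GL: group "GL_V :: ('a \<Rightarrow> 'a) monoid" by (rule group_GL_V)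
  have roots_of: "\<exists>p. set p \<subseteq> \<Phi> \<and> us = map s p" if "set us \<subseteq> reflections B \<Phi>" for us
    using that
  proof (induction us)
    case (Cons u us)
    then obtain p a where "set p \<subseteq> \<Phi>" "us = map s p" "a \<in> \<Phi>" "u = s a"
      by (auto simp: reflections_def)
    then show ?case by (intro exI[of _ "a # p"]) simp
  qed simp
  obtain p where p: "set p \<subseteq> \<Phi>" "ts = map s p" using roots_of[of ts] ts by (auto simp: Red_gen_def)
  obtain q where q: "set q \<subseteq> \<Phi>" "rs = map s q" using roots_of[of rs] rs by (auto simp: Red_gen_def)
  have len: "length p = n + 2" "length q = n + 2" and c: "W p = c" "W q = c"
    and gen: "G p = weyl_group B \<Phi>" "G q = weyl_group B \<Phi>"
    using ts rs by (simp_all add: Red_gen_def p(2) q(2) W_def)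
  let ?p1 = "take h p" and ?p2 = "drop h p" and ?q1 = "take h q" and ?q2 = "drop h q"
  have W1: "W ?p1 = W ?q1" using eq1 by (simp add: W_def p(2) q(2) take_map)
  \<comment> \<open>Cancelling the common initial product shows that the final products agree too,
    which the exchange of the final parts requires.\<close>
  have "W ?p1 (W ?p2 v) = W ?p1 (W ?q2 v)" for v
    using W_append[of ?p1 ?p2 v] W_append[of ?q1 ?q2 v] c W1 by simp
  moreover have "inj (W ?p1)"
    using bij_W[of ?p1] norm p(1) set_take_subset[of h p] by (simp add: bij_is_inj subset_iff)
  ultimately have W2: "W ?p2 = W ?q2" by (auto simp: inj_eq)
  have cox: "v \<in> radical B" if "v - W (?p1 @ ?p2) v \<in> radical B" for v
  proof (rule coxeter_fixed_mod_radical[OF assms(3) norm spanning dimR fd])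
    show "v - c v \<in> radical B" using that unfolding append_take_drop_id c(1) .
  qed
  have "weyl_group B \<Phi> \<subseteq> G (?p1 @ ?q2)"
    using rigidity[OF norm int irr X spanning dimR fd _ _ _ _ _ _ _ W1 W2 cox] len p(1) q(1) gen assms(2)
    by simp
  moreover have mix: "set (?p1 @ ?q2) \<subseteq> \<Phi>"
    using p(1) q(1) set_take_subset[of h p] set_drop_subset[of h q] by auto
  then have "G (?p1 @ ?q2) \<subseteq> weyl_group B \<Phi>"
    unfolding weyl_group_def reflections_def by (intro GL.mono_generate image_mono)
  moreover have "W (?p1 @ ?q2) = c"
    using W_append[of ?p1 ?q2] W_append[of ?q1 ?q2] W1 c(2) by (simp add: fun_eq_iff)
  ultimately show "take h ts @ drop h rs \<in> Red_gen B \<Phi> n c"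
    using mix len h by (auto simp: Red_gen_def p(2) q(2) W_def take_map drop_map reflections_def image_Un)
qed

end
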